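(* Let $E$ be an lcHs over $\mathbb{K}$, let $\mathcal{F}(\Omega)$ and $\mathcal{F}(\Omega,E)$ be $\varepsilon$-compatible, and let $(f_{n})_{n\in\mathbb{N}}$ be an equicontinuous Schauder basis of $\mathcal{F}(\Omega)$ with associated coefficient functionals $\lambda^{\mathbb{K}}:=(\lambda_{n}^{\mathbb{K}})_{n\in\mathbb{N}}$. Let there be $\lambda^{E}\colon\mathcal{F}(\Omega,E)\to E^{\mathbb{N}}$ such that $(\lambda^{E},\lambda^{\mathbb{K}})$ is a consistent family for $(\mathcal{F},E)$, and set $Q_{n}^{E}\colon\mathcal{F}(\Omega,E)\to\mathcal{F}(\Omega,E)$, $Q_{n}^{E}(f):=\lambda_{n}^{E}(f)f_{n}$, for every $n\in\mathbb{N}$. Then the following holds: a) The sequence $(P_{k}^{E})_{k\in\mathbb{N}}$ given by $P_{k}^{E}:=\sum_{n=1}^{k}Q_{n}^{E}$ is a Schauder decomposition of $\mathcal{F}(\Omega,E)$. b) Each $f\in\mathcal{F}(\Omega,E)$ has the series representation $f=\sum_{n=1}^{\infty}\lambda_{n}^{E}(f)f_{n}$. c) $\mathcal{F}(\Omega)\otimes E$ is sequentially dense in $\mathcal{F}(\Omega,E)$.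
   Context: $\mathbb{K}=\mathbb{R}$ or $\mathbb{C}$. An lcHs is a non-trivial locally convex Hausdorff space over $\mathbb{K}$. For an lcHs $F$, $F'_{\kappa}$ is $F'$ with the topology of uniform convergence on absolutely convex compact subsets of $F$; $F\varepsilon E:=L_{e}(F'_{\kappa},E)$ carries the topology of uniform convergence on equicontinuous subsets of $F'$. $\mathcal{F}(\Omega)\subset\mathbb{K}^{\Omega}$ and $\mathcal{F}(\Omega,E)\subset E^{\Omega}$ are lcHs of functions on a non-empty set $\Omega$ such that $\delta_x\in\mathcal{F}(\Omega)'$, $\delta_x(f):=f(x)$, for all $x\in\Omega$. They are $\varepsilon$-compatible if $S\colon\mathcal{F}(\Omega)\varepsilon E\to\mathcal{F}(\Omega,E)$, $u\mapsto[x\mapsto u(\delta_x)]$, is a well-defined topological isomorphism. $\mathcal{F}(\Omega)\otimes E$ is regarded as a subspace of $\mathcal{F}(\Omega,E)$ via $f\otimes e\mapsto[x\mapsto f(x)e]$, and for $e\in E$, $f_n\in\mathcal{F}(\Omega)$, $ef_n$ denotes $x\mapsto f_n(x)e$. $(f_n)$ is a Schauder basis of $\mathcal{F}(\Omega)$ if every $f$ has a unique expansion $f=\sum_{n}\lambda^{\mathbb{K}}_n(f)f_n$ converging in $\mathcal{F}(\Omega)$ and the coefficient functionals $\lambda^{\mathbb{K}}_n$ are continuous; it is equicontinuous if the operators $f\mapsto\sum_{n=1}^{k}\lambda^{\mathbb{K}}_n(f)f_n$, $k\in\mathbb{N}$, are equicontinuous. $(\lambda^{E},\lambda^{\mathbb{K}})$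 is a consistent family for $(\mathcal{F},E)$ if $\lambda^{E}=(\lambda^{E}_n)_{n\in\mathbb{N}}$ is linear and for all $u\in\mathcal{F}(\Omega)\varepsilon E$, $n\in\mathbb{N}$: $S(u)\in\mathcal{F}(\Omega,E)$, $\lambda^{\mathbb{K}}_n\in\mathcal{F}(\Omega)'$ and $\lambda^{E}_n(S(u))=u(\lambda^{\mathbb{K}}_n)$. A Schauder decomposition of an lcHs $X$ is a sequence $(P_k)_{k\in\mathbb{N}}$ of continuous linear projections on $X$ such that $P_kP_j=P_{\min(j,k)}$ for all $j,k$, $P_k\neq P_j$ for $k\neq j$, and $P_kx\to x$ for each $x\in X$. *)

theory Defs
  imports "HOL-Analysis.Analysis" "HOL-Library.Function_Algebras"
begin

text \<open>
  The scalar field is a type \<open>'k :: {real_normed_field, heine_borel}\<close>. Both \<open>real\<close> and \<open>complex\<close> are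
  instances, and by the Gelfand-Mazur theorem these are the only ones up to isometric isomorphism.

  A topological vector space is given by a scalar multiplication \<open>s\<close> on an ambient abelian group
  and an abstract topology \<open>X\<close> whose carrier \<open>topspace X\<close> is a linear subspace. In this way spaces of
  functions, dual spaces and spaces of operators, which occupy only part of a function type, are
  treated uniformly. Functions are added pointwise, by the instances of Function Algebras.
\<close>

definition pw_scale :: "('k \<Rightarrow> 'v \<Rightarrow> 'v) \<Rightarrow> 'k \<Rightarrow> ('a \<Rightarrow> 'v) \<Rightarrow> 'a \<Rightarrow> 'v" where
  "pw_scale s c f = (\<lambda>x. s c (f x))"

lemma vector_space_pw_scale:
  assumes "vector_space s"
  shows "vector_space (pw_scale s)"
proof -
  interpret vector_space s by fact
  show ?thesis
    by unfold_locales
      (auto simp: pw_scale_def fun_eq_iff scale_right_distrib scale_left_distrib)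
qed

definition convex_wrt :: "('k::real_normed_field \<Rightarrow> 'v::ab_group_add \<Rightarrow> 'v) \<Rightarrow> 'v set \<Rightarrow> bool" where
  "convex_wrt s A \<longleftrightarrow>
    (\<forall>x\<in>A. \<forall>y\<in>A. \<forall>t::real. 0 \<le> t \<and> t \<le> 1 \<longrightarrow> s (of_real (1 - t)) x + s (of_real t) y \<in> A)"

definition abs_convex_wrt :: "('k::real_normed_field \<Rightarrow> 'v::ab_group_add \<Rightarrow> 'v) \<Rightarrow> 'v set \<Rightarrow> bool" where
  "abs_convex_wrt s A \<longleftrightarrow>
    (\<forall>x\<in>A. \<forall>y\<in>A. \<forall>a b. norm a + norm b \<le> 1 \<longrightarrow> s a x + s b y \<in> A)"

definition lcHs :: "('k::real_normed_field \<Rightarrow> 'v::ab_group_add \<Rightarrow> 'v) \<Rightarrow> 'v topology \<Rightarrow> bool" where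
  "lcHs s X \<longleftrightarrow>
    vector_space s \<and> module.subspace s (topspace X) \<and> topspace X \<noteq> {0} \<and>
    continuous_map (prod_topology X X) X (\<lambda>(x, y). x + y) \<and>
    continuous_map (prod_topology euclidean X) X (\<lambda>(c, x). s c x) \<and>
    Hausdorff_space X \<and>
    (\<forall>U. openin X U \<and> 0 \<in> U \<longrightarrow> (\<exists>V. openin X V \<and> 0 \<in> V \<and> V \<subseteq> U \<and> convex_wrt s V))"

definition linear_map_on ::
    "('k \<Rightarrow> 'v::ab_group_add \<Rightarrow> 'v) \<Rightarrow> ('k \<Rightarrow> 'w::ab_group_add \<Rightarrow> 'w) \<Rightarrow> 'v set \<Rightarrow> ('v \<Rightarrow> 'w) \<Rightarrow> bool" where
  "linear_map_on s t A f \<longleftrightarrow>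
    (\<forall>x\<in>A. \<forall>y\<in>A. f (x + y) = f x + f y) \<and> (\<forall>c. \<forall>x\<in>A. f (s c x) = t c (f x))"

text \<open>
  The space \<open>L(X, Y)\<close>. A map defined on \<open>topspace X\<close> is represented by its extension by zero, so that
  equality of operators is equality of functions and \<open>L(X, Y)\<close> is a linear subspace of the
  function type.
\<close>

definition cont_linear ::
    "('k \<Rightarrow> 'v::ab_group_add \<Rightarrow> 'v) \<Rightarrow> 'v topology \<Rightarrow> ('k \<Rightarrow> 'w::ab_group_add \<Rightarrow> 'w) \<Rightarrow> 'w topology
      \<Rightarrow> ('v \<Rightarrow> 'w) set" where
  "cont_linear s X t Y =
    {f. continuous_map X Y f \<and> linear_map_on s t (topspace X) f \<and> (\<forall>x. x \<notin> topspace X \<longrightarrow> f x = 0)}"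

definition top_dual ::
    "('k::real_normed_field \<Rightarrow> 'v::ab_group_add \<Rightarrow> 'v) \<Rightarrow> 'v topology \<Rightarrow> ('v \<Rightarrow> 'k) set" where
  "top_dual s X = cont_linear s X (*) euclidean"

definition equicontinuous_set ::
    "'v topology \<Rightarrow> 'w::ab_group_add topology \<Rightarrow> ('v \<Rightarrow> 'w) set \<Rightarrow> bool" where
  "equicontinuous_set X Y H \<longleftrightarrow>
    (\<forall>x\<in>topspace X. \<forall>V. openin Y V \<and> 0 \<in> V \<longrightarrow>
      (\<exists>U. openin X U \<and> x \<in> U \<and> (\<forall>h\<in>H. \<forall>y\<in>U. h y - h x \<in> V)))"

text \<open>
  The topology on a set \<open>L\<close> of functions into \<open>Y\<close> of uniform convergence on the members of
  \<open>\<S>\<close>: the sets \<open>{g \<in> L. \<forall>A\<in>\<A>. \<forall>x\<in>A. g x - f x \<in> V}\<close>, for finite \<open>\<A> \<subseteq> \<S>\<close> and \<open>V\<close> a neighbourhood of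
  zero, form a neighbourhood base at \<open>f\<close>.
\<close>

definition uniform_topology ::
    "('a \<Rightarrow> 'w::ab_group_add) set \<Rightarrow> 'a set set \<Rightarrow> 'w topology \<Rightarrow> ('a \<Rightarrow> 'w) topology" where
  "uniform_topology L \<S> Y = topology (\<lambda>W. W \<subseteq> L \<and>
    (\<forall>f\<in>W. \<exists>\<A> V. finite \<A> \<and> \<A> \<subseteq> \<S> \<and> openin Y V \<and> 0 \<in> V \<and>
      {g\<in>L. \<forall>A\<in>\<A>. \<forall>x\<in>A. g x - f x \<in> V} \<subseteq> W))"

lemma openin_uniform_topology:
  "openin (uniform_topology L \<S> Y) W \<longleftrightarrow> W \<subseteq> L \<and>
    (\<forall>f\<in>W. \<exists>\<A> V. finite \<A> \<and> \<A> \<subseteq> \<S> \<and> openin Y V \<and> 0 \<in> V \<and>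
      {g\<in>L. \<forall>A\<in>\<A>. \<forall>x\<in>A. g x - f x \<in> V} \<subseteq> W)"
proof -
  define nb where "nb W f \<longleftrightarrow> (\<exists>\<A> V. finite \<A> \<and> \<A> \<subseteq> \<S> \<and> openin Y V \<and> 0 \<in> V \<and>
    {g\<in>L. \<forall>A\<in>\<A>. \<forall>x\<in>A. g x - f x \<in> V} \<subseteq> W)" for W f
  have inter: "nb (S \<inter> T) f" if S: "nb S f" and T: "nb T f" for S T f
  proof -
    obtain \<A> V where 1: "finite \<A>" "\<A> \<subseteq> \<S>" "openin Y V" "0 \<in> V"
        "{g\<in>L. \<forall>A\<in>\<A>. \<forall>x\<in>A. g x - f x \<in> V} \<subseteq> S"
      using S unfolding nb_def by (elim exE conjE)
    obtain \<B> U where 2: "finite \<B>" "\<B> \<subseteq> \<S>" "openin Y U" "0 \<in> U"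
        "{g\<in>L. \<forall>A\<in>\<B>. \<forall>x\<in>A. g x - f x \<in> U} \<subseteq> T"
      using T unfolding nb_def by (elim exE conjE)
    have "{g\<in>L. \<forall>A\<in>\<A> \<union> \<B>. \<forall>x\<in>A. g x - f x \<in> V \<inter> U} \<subseteq> S \<inter> T"
      by (rule order_trans[OF _ Int_mono[OF 1(5) 2(5)]]) blast
    moreover have "finite (\<A> \<union> \<B>)" "\<A> \<union> \<B> \<subseteq> \<S>" "openin Y (V \<inter> U)" "0 \<in> V \<inter> U"
      using 1(1-4) 2(1-4) by (simp_all add: openin_Int)
    ultimately show ?thesis
      unfolding nb_def by (intro exI conjI)
  qed
  have mono: "nb T f" if S: "nb S f" and ST: "S \<subseteq> T" for S T f
  proof -
    obtain \<A> V where 1: "finite \<A>" "\<A> \<subseteq> \<S>" "openin Y V" "0 \<in> V"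
        "{g\<in>L. \<forall>A\<in>\<A>. \<forall>x\<in>A. g x - f x \<in> V} \<subseteq> S"
      using S unfolding nb_def by (elim exE conjE)
    show ?thesis
      unfolding nb_def using 1(1-4) order_trans[OF 1(5) ST] by (intro exI conjI)
  qed
  have "istopology (\<lambda>W. W \<subseteq> L \<and> (\<forall>f\<in>W. nb W f))"
    unfolding istopology_def
  proof (intro conjI allI impI ballI)
    fix S T f
    assume "S \<subseteq> L \<and> (\<forall>f\<in>S. nb S f)" "T \<subseteq> L \<and> (\<forall>f\<in>T. nb T f)" "f \<in> S \<inter> T"
    then show "nb (S \<inter> T) f"
      using inter by simp
  next
    fix \<K> f
    assume K: "\<forall>S\<in>\<K>. S \<subseteq> L \<and> (\<forall>f\<in>S. nb S f)" and "f \<in> \<Union>\<K>"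
    then obtain S where S: "S \<in> \<K>" "f \<in> S" by (elim UnionE)
    then have "nb S f" using K by simp
    then show "nb (\<Union>\<K>) f"
      using S(1) by (rule mono[OF _ Union_upper])
  next
    fix S T
    assume "S \<subseteq> L \<and> (\<forall>f\<in>S. nb S f)"
    then show "S \<inter> T \<subseteq> L" by (simp add: le_infI1)
  next
    fix \<K>
    assume "\<forall>S\<in>\<K>. S \<subseteq> L \<and> (\<forall>f\<in>S. nb S f)"
    then show "\<Union>\<K> \<subseteq> L" by (simp add: Sup_le_iff)
  qed
  then show ?thesis
    unfolding uniform_topology_def nb_def by (simp only: topology_inverse')
qed

lemma topspace_uniform_topology:
  assumes "0 \<in> topspace Y"
  shows "topspace (uniform_topology L \<S> Y) = L"
proof
  show "topspace (uniform_topology L \<S> Y) \<subseteq> L"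
    using openin_topspace[of "uniform_topology L \<S> Y"]
    unfolding openin_uniform_topology by blast
  have "openin (uniform_topology L \<S> Y) L"
    unfolding openin_uniform_topology using assms
    by (intro conjI ballI exI[of _ "{}"] exI[of _ "topspace Y"]) simp_all
  then show "L \<subseteq> topspace (uniform_topology L \<S> Y)"
    by (rule openin_subset)
qed

definition kappa_dual ::
    "('k::real_normed_field \<Rightarrow> 'v::ab_group_add \<Rightarrow> 'v) \<Rightarrow> 'v topology \<Rightarrow> ('v \<Rightarrow> 'k) topology" where
  "kappa_dual s X = uniform_topology (top_dual s X) {K. compactin X K \<and> abs_convex_wrt s K} euclidean"

definition eps_product ::
    "('k::real_normed_field \<Rightarrow> 'v::ab_group_add \<Rightarrow> 'v) \<Rightarrow> 'v topology \<Rightarrow>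
     ('k \<Rightarrow> 'e::ab_group_add \<Rightarrow> 'e) \<Rightarrow> 'e topology \<Rightarrow> (('v \<Rightarrow> 'k) \<Rightarrow> 'e) topology" where
  "eps_product s X t E =
    uniform_topology (cont_linear (pw_scale (*)) (kappa_dual s X) t E)
      {H. H \<subseteq> top_dual s X \<and> equicontinuous_set X euclidean H} E"

text \<open>
  A non-empty set \<open>\<Omega>\<close> is represented by a type \<open>'x\<close>.
  The evaluation functional is extended by zero, like every element of the dual.
\<close>

definition pt_eval :: "('x \<Rightarrow> 'k::real_normed_field) topology \<Rightarrow> 'x \<Rightarrow> ('x \<Rightarrow> 'k) \<Rightarrow> 'k" where
  "pt_eval F x = (\<lambda>f. if f \<in> topspace F then f x else 0)"

definition eps_map ::
    "('x \<Rightarrow> 'k::real_normed_field) topology \<Rightarrow> ((('x \<Rightarrow> 'k) \<Rightarrow> 'k) \<Rightarrow> 'e) \<Rightarrow> 'x \<Rightarrow> 'e" where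
  "eps_map F u = (\<lambda>x. u (pt_eval F x))"

definition function_space ::
    "('x \<Rightarrow> 'k::real_normed_field) topology \<Rightarrow> bool" where
  "function_space F \<longleftrightarrow>
    lcHs (pw_scale (*)) F \<and> (\<forall>x. pt_eval F x \<in> top_dual (pw_scale (*)) F)"

definition vector_function_space ::
    "('k::real_normed_field \<Rightarrow> 'e::ab_group_add \<Rightarrow> 'e) \<Rightarrow> 'e topology \<Rightarrow> ('x \<Rightarrow> 'e) topology \<Rightarrow> bool" where
  "vector_function_space s E FE \<longleftrightarrow>
    lcHs (pw_scale s) FE \<and> (\<forall>f\<in>topspace FE. range f \<subseteq> topspace E)"

definition eps_compatible ::
    "('k::real_normed_field \<Rightarrow> 'e::ab_group_add \<Rightarrow> 'e) \<Rightarrow> 'e topology \<Rightarrow>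
     ('x \<Rightarrow> 'k) topology \<Rightarrow> ('x \<Rightarrow> 'e) topology \<Rightarrow> bool" where
  "eps_compatible s E F FE \<longleftrightarrow>
    linear_map_on (pw_scale s) (pw_scale s) (topspace (eps_product (pw_scale (*)) F s E)) (eps_map F) \<and>
    homeomorphic_map (eps_product (pw_scale (*)) F s E) FE (eps_map F)"

text \<open>Sequences are indexed from \<open>0\<close>, so the \<open>k\<close>-th partial sum runs over \<open>n \<le> k\<close>.\<close>

definition schauder_basis ::
    "('k::real_normed_field \<Rightarrow> 'v::ab_group_add \<Rightarrow> 'v) \<Rightarrow> 'v topology \<Rightarrow> (nat \<Rightarrow> 'v) \<Rightarrow>
     (nat \<Rightarrow> 'v \<Rightarrow> 'k) \<Rightarrow> bool" where
  "schauder_basis s X b l \<longleftrightarrow>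
    (\<forall>n. b n \<in> topspace X) \<and> (\<forall>n. l n \<in> top_dual s X) \<and>
    (\<forall>x\<in>topspace X.
      limitin X (\<lambda>k. \<Sum>n\<le>k. s (l n x) (b n)) x sequentially \<and>
      (\<forall>a. limitin X (\<lambda>k. \<Sum>n\<le>k. s (a n) (b n)) x sequentially \<longrightarrow> (\<forall>n. a n = l n x)))"

definition equicontinuous_schauder_basis ::
    "('k::real_normed_field \<Rightarrow> 'v::ab_group_add \<Rightarrow> 'v) \<Rightarrow> 'v topology \<Rightarrow> (nat \<Rightarrow> 'v) \<Rightarrow>
     (nat \<Rightarrow> 'v \<Rightarrow> 'k) \<Rightarrow> bool" where
  "equicontinuous_schauder_basis s X b l \<longleftrightarrow>
    schauder_basis s X b l \<and>
    equicontinuous_set X X (range (\<lambda>k x. \<Sum>n\<le>k. s (l n x) (b n)))"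

definition consistent_family ::
    "('k::real_normed_field \<Rightarrow> 'e::ab_group_add \<Rightarrow> 'e) \<Rightarrow> 'e topology \<Rightarrow>
     ('x \<Rightarrow> 'k) topology \<Rightarrow> ('x \<Rightarrow> 'e) topology \<Rightarrow>
     (nat \<Rightarrow> ('x \<Rightarrow> 'e) \<Rightarrow> 'e) \<Rightarrow> (nat \<Rightarrow> ('x \<Rightarrow> 'k) \<Rightarrow> 'k) \<Rightarrow> bool" where
  "consistent_family s E F FE lE lK \<longleftrightarrow>
    (\<forall>n. lE n ` topspace FE \<subseteq> topspace E \<and> linear_map_on (pw_scale s) s (topspace FE) (lE n)) \<and>
    (\<forall>u\<in>topspace (eps_product (pw_scale (*)) F s E). \<forall>n.
      eps_map F u \<in> topspace FE \<and> lK n \<in> top_dual (pw_scale (*)) F \<and>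
      lE n (eps_map F u) = u (lK n))"

definition schauder_decomposition ::
    "('k \<Rightarrow> 'v::ab_group_add \<Rightarrow> 'v) \<Rightarrow> 'v topology \<Rightarrow> (nat \<Rightarrow> 'v \<Rightarrow> 'v) \<Rightarrow> bool" where
  "schauder_decomposition s X P \<longleftrightarrow>
    (\<forall>k. continuous_map X X (P k) \<and> linear_map_on s s (topspace X) (P k) \<and>
      (\<forall>x\<in>topspace X. P k (P k x) = P k x)) \<and>
    (\<forall>j k. \<forall>x\<in>topspace X. P k (P j x) = P (min j k) x) \<and>
    (\<forall>j k. k \<noteq> j \<longrightarrow> (\<exists>x\<in>topspace X. P k x \<noteq> P j x)) \<and>
    (\<forall>x\<in>topspace X. limitin X (\<lambda>k. P k x) x sequentially)"

definition elem_tensor :: "('k \<Rightarrow> 'e \<Rightarrow> 'e) \<Rightarrow> ('x \<Rightarrow> 'k) \<Rightarrow> 'e \<Rightarrow> 'x \<Rightarrow> 'e" where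
  "elem_tensor s f e = (\<lambda>x. s (f x) e)"

definition tensor_subspace ::
    "('k::real_normed_field \<Rightarrow> 'e::ab_group_add \<Rightarrow> 'e) \<Rightarrow> 'e topology \<Rightarrow> ('x \<Rightarrow> 'k) topology \<Rightarrow>
     ('x \<Rightarrow> 'e) set" where
  "tensor_subspace s E F =
    module.span (pw_scale s) {elem_tensor s f e | f e. f \<in> topspace F \<and> e \<in> topspace E}"

definition sequentially_dense :: "'v topology \<Rightarrow> 'v set \<Rightarrow> bool" where
  "sequentially_dense X D \<longleftrightarrow> D \<subseteq> topspace X \<and>
    (\<forall>x\<in>topspace X. \<exists>d::nat \<Rightarrow> 'v. (\<forall>n. d n \<in> D) \<and> limitin X d x sequentially)"

end

theory Submission
  imports Defs
begin

text \<open>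
  Let \<open>P\<^sub>k\<close> be the partial sum operators of the basis of \<open>F\<close>. For \<open>u\<close> in the \<open>\<epsilon>\<close>-product, the vector-valued
  partial sum at \<open>S u\<close> is the \<open>S\<close>-image of \<open>y \<mapsto> u (y \<circ> P\<^sub>k) = \<Sum>n\<le>k. y (f n) \<cdot> u (\<lambda>\<^sub>n)\<close>. By
  equicontinuity \<open>P\<^sub>k\<close> tends to the identity uniformly on compact sets, so \<open>y \<circ> P\<^sub>k\<close> tends to \<open>y\<close> in the
  \<open>\<kappa>\<close>-dual, uniformly for \<open>y\<close> in an equicontinuous set. Since \<open>u\<close> is continuous on the \<open>\<kappa>\<close>-dual, these
  operators tend to \<open>u\<close> in the \<open>\<epsilon>\<close>-product, and the isomorphism \<open>S\<close> carries the convergence over.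
\<close>

section \<open>Continuity and zero neighbourhoods in a locally convex space\<close>

lemma openin_prod_topology_box:
  assumes "openin (prod_topology X Y) S" "(x, y) \<in> S"
  obtains A B where "openin X A" "openin Y B" "x \<in> A" "y \<in> B" "A \<times> B \<subseteq> S"
  using assms by (metis openin_prod_topology_alt)

locale lc_space =
  fixes s :: "'k::real_normed_field \<Rightarrow> 'v::ab_group_add \<Rightarrow> 'v" and X :: "'v topology"
  assumes lcHs: "lcHs s X"
begin

sublocale vector_space s
  using lcHs by (simp add: lcHs_def)

lemma subspace_topspace: "subspace (topspace X)"
  using lcHs by (simp add: lcHs_def)

lemma zero_in_topspace: "0 \<in> topspace X"
  by (rule subspace_0[OF subspace_topspace])

lemma continuous_map_lc_add:
  assumes "continuous_map Z X f" "continuous_map Z X g"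
  shows "continuous_map Z X (\<lambda>z. f z + g z)"
proof -
  have "continuous_map (prod_topology X X) X (\<lambda>(x, y). x + y)"
    using lcHs by (simp add: lcHs_def)
  from continuous_map_compose[OF continuous_map_pairedI[OF assms] this]
  show ?thesis by (simp add: o_def)
qed

lemma continuous_map_lc_scale:
  assumes "continuous_map Z euclidean c" "continuous_map Z X f"
  shows "continuous_map Z X (\<lambda>z. s (c z) (f z))"
proof -
  have "continuous_map (prod_topology euclidean X) X (\<lambda>(c, x). s c x)"
    using lcHs by (simp add: lcHs_def)
  from continuous_map_compose[OF continuous_map_pairedI[OF assms] this]
  show ?thesis by (simp add: o_def)
qed

lemma continuous_map_lc_sum:
  assumes "\<And>i. i \<in> I \<Longrightarrow> continuous_map Z X (f i)"
  shows "continuous_map Z X (\<lambda>z. \<Sum>i\<in>I. f i z)"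
  using assms
  by (induction I rule: infinite_finite_induct)
    (auto intro: continuous_map_lc_add simp: zero_in_topspace)

lemma continuous_map_translate:
  assumes "a \<in> topspace X"
  shows "continuous_map X X (\<lambda>x. x + a)"
  by (rule continuous_map_lc_add) (use assms in auto)

lemma continuous_map_diff_const:
  assumes "a \<in> topspace X"
  shows "continuous_map X X (\<lambda>x. x - a)"
  using continuous_map_translate[OF subspace_neg[OF subspace_topspace assms]] by simp

lemma continuous_map_const_diff:
  assumes "a \<in> topspace X"
  shows "continuous_map X X (\<lambda>x. a - x)"
proof -
  have "continuous_map X X (\<lambda>x. s (- 1) x + a)"
    by (intro continuous_map_lc_add continuous_map_lc_scale) (use assms in auto)
  then show ?thesis by simp
qed

text \<open>Addition is continuous at \<open>(0, 0)\<close>, so the preimage of \<open>U\<close>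
  contains a product box around it; the intersection of the two sides serves for both
  summands.\<close>

lemma add_nhd:
  assumes "openin X U" "0 \<in> U"
  obtains V where "openin X V" "0 \<in> V" "\<And>x y. x \<in> V \<Longrightarrow> y \<in> V \<Longrightarrow> x + y \<in> U"
proof -
  have "continuous_map (prod_topology X X) X (\<lambda>(x, y). x + y)"
    using lcHs by (simp add: lcHs_def)
  then have "openin (prod_topology X X)
      {p \<in> topspace (prod_topology X X). (\<lambda>(x, y). x + y) p \<in> U}"
    using assms(1) by (rule openin_continuous_map_preimage)
  moreover have "(0, 0) \<in> {p \<in> topspace (prod_topology X X). (\<lambda>(x, y). x + y) p \<in> U}"
    using assms zero_in_topspace by simp
  ultimately obtain A B where AB: "openin X A" "openin X B" "0 \<in> A" "0 \<in> B"
      "A \<times> B \<subseteq> {p \<in> topspace (prod_topology X X). (\<lambda>(x, y). x + y) p \<in> U}"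
    by (rule openin_prod_topology_box)
  show ?thesis
    by (rule that[of "A \<inter> B"]) (use AB in auto)
qed

text \<open>Two applications of \<open>add_nhd\<close>: the first two summands come from
  \<open>W\<close> and add up into \<open>V\<close>, where the third one lies. It supplies the room
  for the three-term estimate in \<open>equicontinuous_uniform_convergence\<close>.\<close>

lemma add3_nhd:
  assumes "openin X U" "0 \<in> U"
  obtains V where "openin X V" "0 \<in> V"
    "\<And>x y z. x \<in> V \<Longrightarrow> y \<in> V \<Longrightarrow> z \<in> V \<Longrightarrow> x + y + z \<in> U"
proof -
  obtain V where V: "openin X V" "0 \<in> V" "\<And>x y. x \<in> V \<Longrightarrow> y \<in> V \<Longrightarrow> x + y \<in> U"
    using add_nhd[OF assms] by metis
  obtain W where W: "openin X W" "0 \<in> W" "\<And>x y. x \<in> W \<Longrightarrow> y \<in> W \<Longrightarrow> x + y \<in> V"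
    using add_nhd[OF V(1,2)] by metis
  show ?thesis
    by (rule that[of "V \<inter> W"]) (use V W in auto)
qed

text \<open>Continuity at \<open>(0, 0)\<close> controls only scalars of norm below some
  \<open>d\<close>. Larger ones are absorbed by a fixed factor \<open>a\<close>, since
  \<open>s c x = s (c / a) (s a x)\<close>, and the preimage of \<open>B\<close> under scaling by
  \<open>a\<close> is again open.\<close>

lemma bounded_scale_nhd:
  assumes "openin X U" "0 \<in> U"
  obtains V where "openin X V" "0 \<in> V" "\<And>(c::'k) x. norm c \<le> M \<Longrightarrow> x \<in> V \<Longrightarrow> s c x \<in> U"
proof -
  have "continuous_map (prod_topology euclidean X) X (\<lambda>(c, x). s c x)"
    using lcHs by (simp add: lcHs_def)
  then have "openin (prod_topology euclidean X)
      {p \<in> topspace (prod_topology euclidean X). (\<lambda>(c, x). s c x) p \<in> U}"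
    using assms(1) by (rule openin_continuous_map_preimage)
  moreover have "(0, 0) \<in> {p \<in> topspace (prod_topology euclidean X). (\<lambda>(c, x). s c x) p \<in> U}"
    using assms zero_in_topspace by simp
  ultimately obtain A B where AB: "openin euclidean A" "openin X B" "0 \<in> A" "0 \<in> B"
      "A \<times> B \<subseteq> {p \<in> topspace (prod_topology euclidean X). (\<lambda>(c, x). s c x) p \<in> U}"
    by (rule openin_prod_topology_box)
  obtain d where d: "d > 0" "ball 0 d \<subseteq> A"
    using AB(1,3) by (metis open_contains_ball open_openin)
  \<comment> \<open>The norm of \<open>a\<close> is large enough that \<open>norm c \<le> M\<close>
    gives \<open>norm (c / a) < d\<close>; the form \<open>\<bar>M\<bar> + 1\<close> keeps
    \<open>a\<close> non-zero for every real \<open>M\<close>.\<close>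
  define a :: 'k where "a = of_real ((\<bar>M\<bar> + 1) / d)"
  have a: "norm a = (\<bar>M\<bar> + 1) / d" "a \<noteq> 0"
    unfolding a_def norm_of_real of_real_eq_0_iff using d(1) by auto
  have "continuous_map X X (\<lambda>x. s a x)"
    by (rule continuous_map_lc_scale) auto
  then have op: "openin X {x \<in> topspace X. s a x \<in> B}"
    using AB(2) by (rule openin_continuous_map_preimage)
  show ?thesis
  proof (rule that[OF op])
    show "0 \<in> {x \<in> topspace X. s a x \<in> B}"
      using AB(4) zero_in_topspace by simp
  next
    fix c :: 'k and x assume c: "norm c \<le> M" and x: "x \<in> {x \<in> topspace X. s a x \<in> B}"
    have "norm (c / a) < d"
    proof -
      have "norm c * d < (\<bar>M\<bar> + 1) * d"
        using c d(1) by (intro mult_strict_right_mono) auto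
      then show ?thesis
        using d(1) by (simp add: norm_divide a(1) field_simps)
    qed
    then have "c / a \<in> A" using d(2) by auto
    then have "s (c / a) (s a x) \<in> U" using x AB(5) by auto
    then show "s c x \<in> U" using a(2) by simp
  qed
qed

lemma absorbing_nhd:
  assumes "openin X U" "0 \<in> U" "x \<in> topspace X"
  obtains c where "c \<noteq> 0" "s c x \<in> U"
proof -
  have "continuous_map euclidean X (\<lambda>c. s c x)"
    by (rule continuous_map_lc_scale) (use assms in auto)
  from openin_continuous_map_preimage[OF this assms(1)]
  have "open {c. s c x \<in> U}" by simp
  moreover have "0 \<in> {c. s c x \<in> U}" using assms by simp
  ultimately obtain d where d: "d > 0" "ball 0 d \<subseteq> {c. s c x \<in> U}"
    by (metis open_contains_ball)
  have "of_real (d / 2) \<in> ball (0::'k) d"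
    unfolding mem_ball_0 norm_of_real using d(1) by simp
  then have "s (of_real (d / 2)) x \<in> U" using d(2) by blast
  moreover have "of_real (d / 2) \<noteq> (0::'k)"
    unfolding of_real_eq_0_iff using d(1) by simp
  ultimately show ?thesis by (rule that[rotated])
qed

text \<open>The Ascoli-type argument: cover \<open>K\<close> by finitely many patches with centres
  \<open>x\<close>, and for \<open>y\<close> in such a patch split \<open>P k y - y\<close> into
  \<open>P k y - P k x\<close>, \<open>P k x - x\<close> and \<open>x - y\<close>. Equicontinuity
  bounds the first term for all \<open>k\<close> at once, and pointwise convergence the
  second.\<close>

lemma equicontinuous_uniform_convergence:
  fixes P :: "nat \<Rightarrow> 'v \<Rightarrow> 'v"
  assumes equi: "equicontinuous_set X X (range P)"
    and lim: "\<And>x. x \<in> topspace X \<Longrightarrow> limitin X (\<lambda>k. P k x) x sequentially"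
    and K: "compactin X K" and U: "openin X U" "0 \<in> U"
  shows "\<forall>\<^sub>F k in sequentially. \<forall>x\<in>K. P k x - x \<in> U"
proof -
  obtain V where V: "openin X V" "0 \<in> V"
      "\<And>x y z. x \<in> V \<Longrightarrow> y \<in> V \<Longrightarrow> z \<in> V \<Longrightarrow> x + y + z \<in> U"
    using add3_nhd[OF U] by metis
  have KX: "K \<subseteq> topspace X" by (rule compactin_subset_topspace[OF K])
  \<comment> \<open>One patch around \<open>x\<close> controls both terms that involve
    \<open>y\<close>, independently of \<open>k\<close>.\<close>
  have "\<exists>W. openin X W \<and> x \<in> W \<and> (\<forall>k. \<forall>y\<in>W. P k y - P k x \<in> V \<and> x - y \<in> V)"
    if x: "x \<in> K" for x
  proof -
    have xX: "x \<in> topspace X" using x KX by auto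
    obtain W where W: "openin X W" "x \<in> W" "\<forall>h\<in>range P. \<forall>y\<in>W. h y - h x \<in> V"
      using equi xX V(1,2) unfolding equicontinuous_set_def by meson
    have "openin X {y \<in> topspace X. x - y \<in> V}"
      by (rule openin_continuous_map_preimage[OF continuous_map_const_diff[OF xX] V(1)])
    with W xX V(2) show ?thesis
      by (intro exI[of _ "W \<inter> {y \<in> topspace X. x - y \<in> V}"]) auto
  qed
  then obtain W where W: "\<And>x. x \<in> K \<Longrightarrow> openin X (W x) \<and> x \<in> W x \<and>
      (\<forall>k. \<forall>y\<in>W x. P k y - P k x \<in> V \<and> x - y \<in> V)"
    by metis
  have "\<exists>\<F>. finite \<F> \<and> \<F> \<subseteq> W ` K \<and> K \<subseteq> \<Union>\<F>"
    using K W unfolding compactin_def by (elim conjE allE[of _ "W ` K"]) blast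
  then obtain J where J: "finite J" "J \<subseteq> K" "K \<subseteq> \<Union>(W ` J)"
    by (metis finite_subset_image)
  \<comment> \<open>There are only finitely many centres, so a single threshold for \<open>k\<close>
    works for all of them.\<close>
  have "\<forall>\<^sub>F k in sequentially. \<forall>x\<in>J. P k x - x \<in> V"
  proof (intro eventually_ball_finite[OF J(1)] ballI)
    fix x assume "x \<in> J"
    then have xX: "x \<in> topspace X" using J KX by auto
    have "openin X {y \<in> topspace X. y - x \<in> V}"
      by (rule openin_continuous_map_preimage[OF continuous_map_diff_const[OF xX] V(1)])
    moreover have "x \<in> {y \<in> topspace X. y - x \<in> V}" using xX V(2) by simp
    ultimately have "\<forall>\<^sub>F k in sequentially. P k x \<in> {y \<in> topspace X. y - x \<in> V}"
      using lim[OF xX] by (auto simp: limitin_def)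
    then show "\<forall>\<^sub>F k in sequentially. P k x - x \<in> V"
      by (rule eventually_mono) simp
  qed
  then show ?thesis
  proof (rule eventually_mono, intro ballI)
    fix k y assume k: "\<forall>x\<in>J. P k x - x \<in> V" and "y \<in> K"
    then obtain x where x: "x \<in> J" "y \<in> W x" using J(3) by auto
    then have "(P k y - P k x) + (P k x - x) + (x - y) \<in> U"
      using W[of x] J(2) k by (intro V(3)) auto
    then show "P k y - y \<in> U" by simp
  qed
qed

end

section \<open>The scalar field, linear maps on subspaces, and operator spaces\<close>

lemma vector_space_scalars: "vector_space ((*) :: 'k \<Rightarrow> 'k \<Rightarrow> 'k::field)"
  by unfold_locales (auto simp: algebra_simps)

text \<open>With the field itself as a locally convex space, dual spaces become instances of the
  results on \<open>cont_linear\<close>.\<close>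

lemma lc_space_scalars: "lc_space ((*) :: 'k \<Rightarrow> 'k \<Rightarrow> 'k::real_normed_field) euclidean"
proof
  interpret vector_space "(*) :: 'k \<Rightarrow> 'k \<Rightarrow> 'k" by (rule vector_space_scalars)
  have "\<exists>V. openin euclidean V \<and> (0::'k) \<in> V \<and> V \<subseteq> U \<and> convex_wrt (*) V"
    if "openin euclidean U \<and> 0 \<in> U" for U
  proof -
    have "open U" "0 \<in> U" using that by simp_all
    then obtain d where d: "d > 0" "ball 0 d \<subseteq> U"
      by (meson openE)
    \<comment> \<open>Norm balls are convex for the real structure, and \<open>scaleR\<close> is
      multiplication by \<open>of_real\<close>.\<close>
    have "convex_wrt (*) (ball (0::'k) d)"
      using convex_ball[of "0::'k" d]
      by (auto simp: convex_wrt_def convex_alt scaleR_conv_of_real)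
    with d show ?thesis
      by (intro exI[of _ "ball 0 d"]) (simp add: open_openin[symmetric])
  qed
  moreover have "(UNIV :: 'k set) \<noteq> {0}"
    by (metis UNIV_I singletonD zero_neq_one)
  moreover have "continuous_on UNIV (\<lambda>(x::'k, y). x + y)" "continuous_on UNIV (\<lambda>(x::'k, y). x * y)"
    by (auto simp: case_prod_unfold intro!: continuous_intros)
  ultimately show "lcHs ((*) :: 'k \<Rightarrow> 'k \<Rightarrow> 'k) euclidean"
    by (simp add: lcHs_def vector_space_scalars euclidean_product_topology)
qed

lemma linear_map_on_zero:
  assumes "vector_space s" "vector_space t" "linear_map_on s t A f" "0 \<in> A"
  shows "f 0 = 0"
proof -
  interpret s: vector_space s by fact
  interpret t: vector_space t by fact
  have "f (s 0 0) = t 0 (f 0)" using assms(3,4) unfolding linear_map_on_def by blast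
  then show ?thesis by simp
qed

lemma linear_map_on_sum:
  assumes "vector_space s" "vector_space t" "linear_map_on s t A f" "module.subspace s A"
    and "\<And>i. i \<in> I \<Longrightarrow> g i \<in> A"
  shows "f (\<Sum>i\<in>I. g i) = (\<Sum>i\<in>I. f (g i))"
proof -
  interpret s: vector_space s by fact
  have z: "f 0 = 0"
    using linear_map_on_zero[OF assms(1-3)] assms(4) by (simp add: s.subspace_0)
  show ?thesis
    using assms(5)
  proof (induction I rule: infinite_finite_induct)
    case (insert i I)
    then have "(\<Sum>i\<in>I. g i) \<in> A" by (intro s.subspace_sum[OF assms(4)]) auto
    with insert assms(3) show ?case by (simp add: linear_map_on_def)
  qed (auto simp: z)
qed

lemma linear_map_on_diff:
  assumes "vector_space s" "vector_space t" "linear_map_on s t A f" "module.subspace s A"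
    and "x \<in> A" "y \<in> A"
  shows "f (x - y) = f x - f y"
proof -
  interpret s: vector_space s by fact
  have "f (x - y + y) = f (x - y) + f y"
    using assms(3,6) s.subspace_diff[OF assms(4-6)] unfolding linear_map_on_def by blast
  then show ?thesis by simp
qed

lemma subspace_cont_linear:
  assumes "lcHs t Y"
  shows "module.subspace (pw_scale t) (cont_linear s X t Y)"
proof -
  interpret Y: lc_space t Y by unfold_locales fact
  interpret pw: vector_space "pw_scale t" by (rule vector_space_pw_scale) unfold_locales
  show ?thesis
  proof (rule pw.subspaceI)
    show "0 \<in> cont_linear s X t Y"
      by (auto simp: cont_linear_def linear_map_on_def zero_fun_def Y.zero_in_topspace)
  next
    fix f g assume "f \<in> cont_linear s X t Y" "g \<in> cont_linear s X t Y"
    then show "f + g \<in> cont_linear s X t Y"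
      by (auto simp: cont_linear_def linear_map_on_def plus_fun_def Y.scale_right_distrib
          intro: Y.continuous_map_lc_add)
  next
    fix c f assume "f \<in> cont_linear s X t Y"
    then show "pw_scale t c f \<in> cont_linear s X t Y"
      by (auto simp: cont_linear_def linear_map_on_def pw_scale_def Y.scale_right_distrib
          Y.scale_left_commute mult.commute intro: Y.continuous_map_lc_scale)
  qed
qed

lemma subspace_top_dual: "module.subspace (pw_scale (*)) (top_dual s X)"
  unfolding top_dual_def by (rule subspace_cont_linear[OF lc_space.lcHs[OF lc_space_scalars]])

lemma vector_space_dual: "vector_space (pw_scale ((*) :: 'k \<Rightarrow> 'k \<Rightarrow> 'k::real_normed_field))"
  by (rule vector_space_pw_scale[OF vector_space_scalars])

lemma topspace_kappa_dual: "topspace (kappa_dual s X) = top_dual s X"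
  by (simp add: kappa_dual_def topspace_uniform_topology)

section \<open>Topologies of uniform convergence and the \<open>\<kappa>\<close>-dual\<close>

lemma openin_uniform_topologyE:
  assumes "openin (uniform_topology L \<S> Y) W" "f \<in> W"
  obtains \<A> V where "finite \<A>" "\<A> \<subseteq> \<S>" "openin Y V" "0 \<in> V"
    "{g \<in> L. \<forall>A\<in>\<A>. \<forall>x\<in>A. g x - f x \<in> V} \<subseteq> W"
  using assms unfolding openin_uniform_topology by meson

text \<open>Uniform closeness on one member of \<S> containing \<open>a\<close> forces closeness at
  \<open>a\<close>. This serves for the \<open>\<kappa>\<close>-dual, with compact sets, and for the
  \<epsilon>-product, with equicontinuous sets.\<close>

lemma continuous_map_uniform_topology_eval:
  assumes trans: "\<And>b. b \<in> topspace Y \<Longrightarrow> continuous_map Y Y (\<lambda>z. z + b)"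
    and zero: "0 \<in> topspace Y"
    and L: "\<And>f. f \<in> L \<Longrightarrow> f a \<in> topspace Y"
    and A: "A \<in> \<S>" "a \<in> A"
  shows "continuous_map (uniform_topology L \<S> Y) Y (\<lambda>f. f a)"
  unfolding continuous_map topspace_uniform_topology[OF zero]
proof (intro conjI allI impI)
  show "(\<lambda>f. f a) ` L \<subseteq> topspace Y" using L by auto
next
  fix W assume W: "openin Y W"
  show "openin (uniform_topology L \<S> Y) {f \<in> L. f a \<in> W}"
    unfolding openin_uniform_topology
  proof (intro conjI ballI)
    fix f assume f: "f \<in> {f \<in> L. f a \<in> W}"
    \<comment> \<open>\<open>V\<close> is \<open>W\<close> moved back by \<open>f a\<close>, so
      \<open>g a - f a \<in> V\<close> means \<open>g a \<in> W\<close>.\<close>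
    define V where "V = {z \<in> topspace Y. z + f a \<in> W}"
    have "openin Y V" unfolding V_def
      by (rule openin_continuous_map_preimage[OF trans W]) (use f L in auto)
    moreover have "0 \<in> V" using f zero by (simp add: V_def)
    moreover have "{g \<in> L. \<forall>A\<in>{A}. \<forall>x\<in>A. g x - f x \<in> V} \<subseteq> {f \<in> L. f a \<in> W}"
      using A(2) by (auto simp: V_def)
    ultimately show "\<exists>\<A> V. finite \<A> \<and> \<A> \<subseteq> \<S> \<and> openin Y V \<and> 0 \<in> V \<and>
        {g \<in> L. \<forall>A\<in>\<A>. \<forall>x\<in>A. g x - f x \<in> V} \<subseteq> {f \<in> L. f a \<in> W}"
      using A(1) by (intro exI[of _ "{A}"] exI[of _ V]) simp
  qed auto
qed

text \<open>The point \<open>x\<close> lies in the set of its multiples \<open>s c x\<close> with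
  \<open>norm c \<le> 1\<close>. This set is absolutely convex, and it is compact because closed
  balls of a \<open>heine_borel\<close> field are.\<close>

lemma continuous_map_kappa_dual_eval:
  fixes s :: "'k::{real_normed_field,heine_borel} \<Rightarrow> 'v::ab_group_add \<Rightarrow> 'v"
  assumes "lcHs s X" "x \<in> topspace X"
  shows "continuous_map (kappa_dual s X) euclidean (\<lambda>y. y x)"
proof -
  interpret X: lc_space s X by unfold_locales fact
  let ?K = "(\<lambda>c. s c x) ` cball 0 1"
  have "continuous_map euclidean X (\<lambda>c. s c x)"
    by (rule X.continuous_map_lc_scale) (use assms in auto)
  then have "compactin X ?K"
    by (rule image_compactin[rotated]) simp
  moreover have "abs_convex_wrt s ?K"
    unfolding abs_convex_wrt_def
  proof (intro ballI allI impI)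
    fix y z and a b :: 'k assume "y \<in> ?K" "z \<in> ?K" and ab: "norm a + norm b \<le> 1"
    then obtain c d where c: "y = s c x" "norm c \<le> 1" and d: "z = s d x" "norm d \<le> 1"
      by (elim imageE) (auto simp only: mem_cball_0)
    have "norm (a * c + b * d) \<le> norm a * norm c + norm b * norm d"
      by (metis norm_mult norm_triangle_ineq)
    also have "\<dots> \<le> norm a * 1 + norm b * 1"
      using c(2) d(2) by (intro add_mono mult_left_mono) auto
    finally have "norm (a * c + b * d) \<le> 1" using ab by simp
    then show "s a y + s b z \<in> ?K"
      unfolding c d by (intro image_eqI[of _ _ "a * c + b * d"]) (auto simp: X.scale_left_distrib)
  qed
  moreover have "x \<in> ?K" by (intro image_eqI[of _ _ 1]) auto
  ultimately show ?thesis
    unfolding kappa_dual_def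
    by (intro continuous_map_uniform_topology_eval[where A = ?K])
      (auto intro!: continuous_intros)
qed

section \<open>Elementary tensors and evaluations in the \<epsilon>-product\<close>

text \<open>The elementary tensor of \<open>x\<close> and \<open>e\<close>, read as an operator on
  the dual. The default \<open>0\<close> off the dual is what membership in
  \<open>cont_linear\<close> demands.\<close>

definition rank_one ::
    "('k::real_normed_field \<Rightarrow> 'v::ab_group_add \<Rightarrow> 'v) \<Rightarrow> 'v topology \<Rightarrow>
     ('k \<Rightarrow> 'e::ab_group_add \<Rightarrow> 'e) \<Rightarrow> 'v \<Rightarrow> 'e \<Rightarrow> ('v \<Rightarrow> 'k) \<Rightarrow> 'e" where
  "rank_one s X t x e = (\<lambda>y. if y \<in> top_dual s X then t (y x) e else 0)"

lemma topspace_eps_product: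
  assumes "lcHs t E"
  shows "topspace (eps_product s X t E) = cont_linear (pw_scale (*)) (kappa_dual s X) t E"
  unfolding eps_product_def
  by (rule topspace_uniform_topology)
    (use lc_space.zero_in_topspace[of t E] assms in \<open>simp add: lc_space_def\<close>)

lemma rank_one_in_cont_linear:
  fixes s :: "'k::{real_normed_field,heine_borel} \<Rightarrow> 'v::ab_group_add \<Rightarrow> 'v"
  assumes "lcHs s X" "lcHs t E" "x \<in> topspace X" "e \<in> topspace E"
  shows "rank_one s X t x e \<in> cont_linear (pw_scale (*)) (kappa_dual s X) t E"
proof -
  interpret E: lc_space t E by unfold_locales fact
  interpret D: vector_space "pw_scale ((*) :: 'k \<Rightarrow> 'k \<Rightarrow> 'k)" by (rule vector_space_dual)
  have "continuous_map (kappa_dual s X) E (\<lambda>y. t (y x) e)"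
    by (rule E.continuous_map_lc_scale[OF continuous_map_kappa_dual_eval])
      (use assms in auto)
  then have "continuous_map (kappa_dual s X) E (rank_one s X t x e)"
    by (rule continuous_map_eq) (simp add: rank_one_def topspace_kappa_dual)
  moreover have "linear_map_on (pw_scale (*)) t (top_dual s X) (rank_one s X t x e)"
    using D.subspace_add[OF subspace_top_dual[of s X]] D.subspace_scale[OF subspace_top_dual[of s X]]
    by (auto simp: linear_map_on_def rank_one_def E.scale_left_distrib)
      (simp add: pw_scale_def)
  ultimately show ?thesis
    by (auto simp: cont_linear_def topspace_kappa_dual rank_one_def)
qed

lemma top_dual_linear:
  assumes "y \<in> top_dual s X"
  shows "linear_map_on s (*) (topspace X) y"
  using assms by (simp add: top_dual_def cont_linear_def)

text \<open>Equicontinuity at \<open>0\<close> gives a zero neighbourhood on which all functionals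
  of \<open>H\<close> stay below \<open>1\<close> in norm. It contains a non-zero multiple
  \<open>s c x\<close>, so \<open>1 / norm c\<close> is a common bound at \<open>x\<close>.\<close>

lemma equicontinuous_set_bounded_at:
  fixes s :: "'k::real_normed_field \<Rightarrow> 'v::ab_group_add \<Rightarrow> 'v"
  assumes "lcHs s X" "H \<subseteq> top_dual s X" "equicontinuous_set X euclidean H" "x \<in> topspace X"
  shows "\<exists>M. \<forall>y\<in>H. norm (y x) \<le> M"
proof -
  interpret X: lc_space s X by unfold_locales fact
  have "openin euclidean (ball (0::'k) 1)" by simp
  then obtain U where U: "openin X U" "0 \<in> U" "\<forall>h\<in>H. \<forall>y\<in>U. h y - h 0 \<in> ball 0 1"
    using assms(3) X.zero_in_topspace unfolding equicontinuous_set_def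
    by (metis centre_in_ball zero_less_one)
  obtain c where c: "c \<noteq> 0" "s c x \<in> U" using X.absorbing_nhd[OF U(1,2) assms(4)] .
  show ?thesis
  proof (intro exI ballI)
    fix y assume y: "y \<in> H"
    then have lin: "linear_map_on s (*) (topspace X) y" using assms(2) top_dual_linear by blast
    have "y 0 = 0"
      by (rule linear_map_on_zero[OF _ vector_space_scalars lin X.zero_in_topspace]) unfold_locales
    moreover have "y (s c x) = c * y x" using lin assms(4) by (simp add: linear_map_on_def)
    ultimately have "norm (c * y x) \<le> 1" using U(3) y c(2) by fastforce
    then show "norm (y x) \<le> 1 / norm c" using c(1) by (simp add: norm_mult field_simps)
  qed
qed

text \<open>On an equicontinuous set the scalars \<open>y x\<close> are bounded, so
  \<open>bounded_scale_nhd\<close> makes \<open>t (y x) (v - e)\<close> small uniformly in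
  \<open>y\<close> once \<open>v\<close> is close to \<open>e\<close>.\<close>

lemma continuous_map_rank_one:
  fixes s :: "'k::{real_normed_field,heine_borel} \<Rightarrow> 'v::ab_group_add \<Rightarrow> 'v"
  assumes "lcHs s X" "lcHs t E" "x \<in> topspace X"
  shows "continuous_map E (eps_product s X t E) (rank_one s X t x)"
  unfolding continuous_map topspace_eps_product[OF assms(2)]
proof (intro conjI allI impI)
  interpret E: lc_space t E by unfold_locales fact
  show "rank_one s X t x ` topspace E \<subseteq> cont_linear (pw_scale (*)) (kappa_dual s X) t E"
    using rank_one_in_cont_linear[OF assms] by auto
  fix W assume W: "openin (eps_product s X t E) W"
  show "openin E {e \<in> topspace E. rank_one s X t x e \<in> W}"
  proof (subst openin_subopen, intro ballI)
    fix e assume e: "e \<in> {e \<in> topspace E. rank_one s X t x e \<in> W}"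
    then have "rank_one s X t x e \<in> W" by simp
    then obtain \<A> V where \<A>: "finite \<A>" "\<A> \<subseteq> {H. H \<subseteq> top_dual s X \<and> equicontinuous_set X euclidean H}"
      and V: "openin E V" "0 \<in> V"
      and sub: "{g \<in> cont_linear (pw_scale (*)) (kappa_dual s X) t E.
          \<forall>A\<in>\<A>. \<forall>y\<in>A. g y - rank_one s X t x e y \<in> V} \<subseteq> W"
      using openin_uniform_topologyE[OF W[unfolded eps_product_def]] by blast
    have "\<forall>A\<in>\<A>. \<exists>M. \<forall>y\<in>A. norm (y x) \<le> M"
      using \<A>(2) equicontinuous_set_bounded_at[OF assms(1) _ _ assms(3)] by blast
    then obtain M where M: "\<And>A y. A \<in> \<A> \<Longrightarrow> y \<in> A \<Longrightarrow> norm (y x) \<le> M A" by metis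
    \<comment> \<open>A common bound for the finitely many members of \<A>; absolute values ensure
      that the sum dominates each term.\<close>
    define B where "B = (\<Sum>A\<in>\<A>. \<bar>M A\<bar>)"
    have B: "norm (y x) \<le> B" if "A \<in> \<A>" "y \<in> A" for A y
    proof -
      have "\<bar>M A\<bar> \<le> B" unfolding B_def by (rule member_le_sum) (use \<A> that in auto)
      with M[OF that] show ?thesis by simp
    qed
    obtain V' where V': "openin E V'" "0 \<in> V'" "\<And>c v. norm c \<le> B \<Longrightarrow> v \<in> V' \<Longrightarrow> t c v \<in> V"
      using E.bounded_scale_nhd[OF V, of B] by blast
    let ?T = "{v \<in> topspace E. v - e \<in> V'}"
    have "openin E ?T"
      by (rule openin_continuous_map_preimage[OF E.continuous_map_diff_const V'(1)]) (use e in auto)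
    moreover have "e \<in> ?T" using e V'(2) by auto
    moreover have "?T \<subseteq> {e \<in> topspace E. rank_one s X t x e \<in> W}"
    proof
      fix v assume v: "v \<in> ?T"
      have "rank_one s X t x v y - rank_one s X t x e y \<in> V" if "A \<in> \<A>" "y \<in> A" for A y
      proof -
        have "y \<in> top_dual s X" using that \<A>(2) by auto
        moreover have "t (y x) (v - e) \<in> V" using V'(3) B[OF that] v by auto
        ultimately show ?thesis by (simp add: rank_one_def E.scale_right_diff_distrib)
      qed
      then show "v \<in> {e \<in> topspace E. rank_one s X t x e \<in> W}"
        using v sub rank_one_in_cont_linear[OF assms] by blast
    qed
    ultimately show "\<exists>T. openin E T \<and> e \<in> T \<and> T \<subseteq> {e \<in> topspace E. rank_one s X t x e \<in> W}"
      by blast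
  qed
qed

text \<open>A single continuous functional forms an equicontinuous set \<open>{l}\<close>, so
  evaluation at \<open>l\<close> is covered by the topology of the \<epsilon>-product.\<close>

lemma continuous_map_eps_product_eval:
  assumes "lcHs t E" "l \<in> top_dual s X"
  shows "continuous_map (eps_product s X t E) E (\<lambda>u. u l)"
proof -
  interpret E: lc_space t E by unfold_locales fact
  interpret S: lc_space "(*) :: 'a \<Rightarrow> 'a \<Rightarrow> 'a" euclidean by (rule lc_space_scalars)
  have "equicontinuous_set X euclidean {l}"
    unfolding equicontinuous_set_def
  proof (intro ballI allI impI)
    fix x and V :: "'a set" assume x: "x \<in> topspace X" and V: "openin euclidean V \<and> 0 \<in> V"
    have "continuous_map X euclidean l" using assms(2) by (simp add: top_dual_def cont_linear_def)
    from continuous_map_compose[OF this S.continuous_map_diff_const[of "l x"]]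
    have "continuous_map X euclidean (\<lambda>y. l y - l x)" by (simp add: o_def)
    then have "openin X {y \<in> topspace X. l y - l x \<in> V}"
      by (rule openin_continuous_map_preimage) (use V in simp)
    then show "\<exists>U. openin X U \<and> x \<in> U \<and> (\<forall>h\<in>{l}. \<forall>y\<in>U. h y - h x \<in> V)"
      using x V by (intro exI[of _ "{y \<in> topspace X. l y - l x \<in> V}"]) auto
  qed
  moreover have "u l \<in> topspace E" if "u \<in> cont_linear (pw_scale (*)) (kappa_dual s X) t E" for u
    using that assms(2) by (auto simp: cont_linear_def topspace_kappa_dual continuous_map_def)
  ultimately show ?thesis
    unfolding eps_product_def using assms(2)
    by (intro continuous_map_uniform_topology_eval[where A = "{l}"])
      (auto intro: E.continuous_map_translate E.zero_in_topspace)
qed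

section \<open>Convergence of the expansion in the \<epsilon>-product\<close>

lemma sum_fun_apply: "(\<Sum>i\<in>I. f i) x = (\<Sum>i\<in>I. f i x)"
  by (induction I rule: infinite_finite_induct) auto

lemma eps_product_expansion:
  fixes s :: "'k::{real_normed_field,heine_borel} \<Rightarrow> 'v::ab_group_add \<Rightarrow> 'v"
  assumes X: "lcHs s X" and E: "lcHs t E"
    and basis: "equicontinuous_schauder_basis s X b l"
    and u: "u \<in> topspace (eps_product s X t E)"
  shows "limitin (eps_product s X t E) (\<lambda>k. \<Sum>n\<le>k. rank_one s X t (b n) (u (l n))) u sequentially"
proof -
  interpret X: lc_space s X by unfold_locales fact
  interpret E: lc_space t E by unfold_locales fact
  interpret D: vector_space "pw_scale ((*) :: 'k \<Rightarrow> 'k \<Rightarrow> 'k)" by (rule vector_space_dual)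
  interpret C: vector_space "pw_scale t" by (rule vector_space_pw_scale) unfold_locales
  let ?L = "cont_linear (pw_scale (*)) (kappa_dual s X) t E"
  let ?T = "\<lambda>k. \<Sum>n\<le>k. rank_one s X t (b n) (u (l n))"
  define P where "P = (\<lambda>k x. \<Sum>n\<le>k. s (l n x) (b n))"
  have b: "b n \<in> topspace X" and l: "l n \<in> top_dual s X" for n
    using basis by (auto simp: equicontinuous_schauder_basis_def schauder_basis_def)
  have equi: "equicontinuous_set X X (range P)"
    and lim: "\<And>x. x \<in> topspace X \<Longrightarrow> limitin X (\<lambda>k. P k x) x sequentially"
    using basis by (auto simp: equicontinuous_schauder_basis_def schauder_basis_def P_def)
  have PX: "P k x \<in> topspace X" for k x
    unfolding P_def
    by (intro X.subspace_sum[OF X.subspace_topspace] X.subspace_scale[OF X.subspace_topspace] b)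
  have uL: "u \<in> ?L" using u by (simp add: topspace_eps_product[OF E])
  have ulin: "linear_map_on (pw_scale (*)) t (top_dual s X) u"
    and ucont: "continuous_map (kappa_dual s X) E u"
    using uL by (auto simp: cont_linear_def topspace_kappa_dual)
  have ul: "u (l n) \<in> topspace E" for n
    using ucont l by (auto simp: continuous_map_def topspace_kappa_dual)
  have TL: "?T k \<in> ?L" for k
    by (intro C.subspace_sum[OF subspace_cont_linear[OF E]] rank_one_in_cont_linear X E b ul)
  have D0: "0 \<in> top_dual s X" by (rule D.subspace_0[OF subspace_top_dual])
  have u0: "u 0 = 0" by (rule linear_map_on_zero[OF _ _ ulin D0]) unfold_locales
  text \<open>The partial sum \<open>?T k\<close> is \<open>u\<close> composed with the transpose of \<open>P k\<close>.\<close>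
  have T_diff: "(\<Sum>n\<le>k. pw_scale (*) (y (b n)) (l n)) - y \<in> top_dual s X"
      "?T k y - u y = u ((\<Sum>n\<le>k. pw_scale (*) (y (b n)) (l n)) - y)"
      "\<And>x. x \<in> topspace X \<Longrightarrow> ((\<Sum>n\<le>k. pw_scale (*) (y (b n)) (l n)) - y) x = y (P k x - x)"
    if y: "y \<in> top_dual s X" for k y
  proof -
    have m: "pw_scale (*) (y (b n)) (l n) \<in> top_dual s X" for n
      by (rule D.subspace_scale[OF subspace_top_dual l])
    then have sm: "(\<Sum>n\<le>k. pw_scale (*) (y (b n)) (l n)) \<in> top_dual s X"
      by (intro D.subspace_sum[OF subspace_top_dual])
    then show "(\<Sum>n\<le>k. pw_scale (*) (y (b n)) (l n)) - y \<in> top_dual s X"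
      using y by (rule D.subspace_diff[OF subspace_top_dual])
    have "?T k y = (\<Sum>n\<le>k. t (y (b n)) (u (l n)))"
      using y by (simp add: rank_one_def sum_fun_apply)
    also have "\<dots> = (\<Sum>n\<le>k. u (pw_scale (*) (y (b n)) (l n)))"
      using ulin l by (simp add: linear_map_on_def)
    also have "\<dots> = u (\<Sum>n\<le>k. pw_scale (*) (y (b n)) (l n))"
      by (rule linear_map_on_sum[OF _ _ ulin subspace_top_dual m, symmetric]) unfold_locales
    also have "\<dots> - u y = u ((\<Sum>n\<le>k. pw_scale (*) (y (b n)) (l n)) - y)"
      by (rule linear_map_on_diff[OF _ _ ulin subspace_top_dual sm y, symmetric]) unfold_locales
    finally show "?T k y - u y = u ((\<Sum>n\<le>k. pw_scale (*) (y (b n)) (l n)) - y)" .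
    fix x assume x: "x \<in> topspace X"
    have ylin: "linear_map_on s (*) (topspace X) y" using y by (rule top_dual_linear)
    have "y (P k x) = (\<Sum>n\<le>k. y (s (l n x) (b n)))"
      unfolding P_def
      by (rule linear_map_on_sum[OF _ vector_space_scalars ylin X.subspace_topspace
            X.subspace_scale[OF X.subspace_topspace b]]) unfold_locales
    also have "\<dots> = (\<Sum>n\<le>k. y (b n) * l n x)"
      using ylin b by (simp add: linear_map_on_def mult.commute)
    finally have "(\<Sum>n\<le>k. pw_scale (*) (y (b n)) (l n)) x = y (P k x)"
      by (simp add: sum_fun_apply pw_scale_def)
    moreover have "y (P k x - x) = y (P k x) - y x"
      by (rule linear_map_on_diff[OF _ vector_space_scalars ylin X.subspace_topspace PX x]) unfold_locales
    ultimately show "((\<Sum>n\<le>k. pw_scale (*) (y (b n)) (l n)) - y) x = y (P k x - x)"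
      by simp
  qed
  show ?thesis
    unfolding limitin_def
  proof (intro conjI allI impI)
    fix W assume W: "openin (eps_product s X t E) W \<and> u \<in> W"
    obtain \<A> V where \<A>: "finite \<A>" "\<A> \<subseteq> {H. H \<subseteq> top_dual s X \<and> equicontinuous_set X euclidean H}"
      and V: "openin E V" "0 \<in> V"
      and sub: "{g \<in> ?L. \<forall>A\<in>\<A>. \<forall>y\<in>A. g y - u y \<in> V} \<subseteq> W"
      using W[unfolded eps_product_def] by (elim conjE openin_uniform_topologyE)
    \<comment> \<open>Continuity of \<open>u\<close> at \<open>0\<close>: for
      \<open>u z \<in> V\<close> it is enough that \<open>z\<close> maps finitely many absolutely
      convex compact sets into \<open>B\<close>.\<close>
    have "openin (kappa_dual s X) {y \<in> top_dual s X. u y \<in> V}"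
      using openin_continuous_map_preimage[OF ucont V(1)] by (simp add: topspace_kappa_dual)
    moreover have "0 \<in> {y \<in> top_dual s X. u y \<in> V}" using D0 u0 V(2) by simp
    ultimately obtain \<K> B where \<K>: "finite \<K>" "\<K> \<subseteq> {K. compactin X K \<and> abs_convex_wrt s K}"
      and B: "openin euclidean B" "0 \<in> B"
      and subB: "{y \<in> top_dual s X. \<forall>K\<in>\<K>. \<forall>x\<in>K. y x - 0 x \<in> B} \<subseteq> {y \<in> top_dual s X. u y \<in> V}"
      unfolding kappa_dual_def by (rule openin_uniform_topologyE)
    have ev: "\<forall>\<^sub>F k in sequentially. \<forall>x\<in>K. \<forall>y\<in>A. y (P k x - x) \<in> B" if "K \<in> \<K>" "A \<in> \<A>" for K A
    proof -
      have A: "A \<subseteq> top_dual s X" "equicontinuous_set X euclidean A" using that \<A> by auto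
      obtain U where U: "openin X U" "0 \<in> U" "\<forall>h\<in>A. \<forall>z\<in>U. h z - h 0 \<in> B"
        using A(2) X.zero_in_topspace B unfolding equicontinuous_set_def by meson
      \<comment> \<open>Functionals vanish at \<open>0\<close>, so equicontinuity there places the
        values \<open>h z\<close> themselves in \<open>B\<close>.\<close>
      have "h 0 = 0" if "h \<in> A" for h
        by (rule linear_map_on_zero[OF X.vector_space_axioms vector_space_scalars top_dual_linear
              X.zero_in_topspace]) (use that A in auto)
      then have "\<forall>h\<in>A. \<forall>z\<in>U. h z \<in> B" using U(3) by (metis diff_zero)
      moreover have "\<forall>\<^sub>F k in sequentially. \<forall>x\<in>K. P k x - x \<in> U"
        by (rule X.equicontinuous_uniform_convergence[OF equi lim _ U(1,2)]) (use that \<K> in auto)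
      ultimately show ?thesis by (auto elim: eventually_mono)
    qed
    \<comment> \<open>Only finitely many pairs \<open>K\<close>, \<open>A\<close> occur, so one
      threshold for \<open>k\<close> serves them all.\<close>
    have "\<forall>\<^sub>F k in sequentially. \<forall>K\<in>\<K>. \<forall>A\<in>\<A>. \<forall>x\<in>K. \<forall>y\<in>A. y (P k x - x) \<in> B"
      by (intro eventually_ball_finite \<K>(1) \<A>(1) ballI ev)
    then show "\<forall>\<^sub>F k in sequentially. ?T k \<in> W"
    proof (rule eventually_mono)
      fix k assume k: "\<forall>K\<in>\<K>. \<forall>A\<in>\<A>. \<forall>x\<in>K. \<forall>y\<in>A. y (P k x - x) \<in> B"
      have "?T k y - u y \<in> V" if A: "A \<in> \<A>" "y \<in> A" for A y
      proof -
        have y: "y \<in> top_dual s X" using A \<A> by auto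
        \<comment> \<open>On the carrier, \<open>?z\<close> is the functional that sends
          \<open>x\<close> to \<open>y (P k x - x)\<close>; the preceding bound makes it small on
          every \<open>K \<in> \<K>\<close>.\<close>
        let ?z = "(\<Sum>n\<le>k. pw_scale (*) (y (b n)) (l n)) - y"
        have "?z x - 0 x \<in> B" if "K \<in> \<K>" "x \<in> K" for K x
        proof -
          have "x \<in> topspace X" using that \<K>(2) compactin_subset_topspace by blast
          then show ?thesis
            using T_diff(3)[OF y] k A that by (simp only: zero_fun_def diff_zero)
        qed
        then have "u ?z \<in> V" using subB T_diff(1)[OF y] by blast
        then show ?thesis by (simp only: T_diff(2)[OF y])
      qed
      then show "?T k \<in> W" using sub TL by blast
    qed
  qed (use u in simp)
qed

section \<open>Biorthogonality, and tensors under \<open>eps_map\<close>\<close>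

text \<open>The one-term expansion of \<open>b m\<close> has eventually constant partial sums, so
  uniqueness of coefficients identifies its coefficients with \<open>l n (b m)\<close>.\<close>

lemma schauder_basis_biorthogonal:
  assumes "lcHs s X" "schauder_basis s X b l"
  shows "l n (b m) = (if n = m then 1 else 0)"
proof -
  interpret X: lc_space s X by unfold_locales fact
  let ?a = "\<lambda>n. if n = m then 1 else 0"
  have b: "b m \<in> topspace X" using assms(2) by (simp add: schauder_basis_def)
  have "(\<Sum>n\<le>k. s (?a n) (b n)) = (if m \<le> k then b m else 0)" for k
  proof -
    have "(\<Sum>n\<le>k. s (?a n) (b n)) = (\<Sum>n\<le>k. if n = m then b n else 0)"
      by (rule sum.cong) auto
    then show ?thesis by simp
  qed
  moreover have "\<forall>\<^sub>F k in sequentially. (if m \<le> k then b m else 0) = b m"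
    using eventually_ge_at_top[of m] by eventually_elim simp
  then have "limitin X (\<lambda>k. if m \<le> k then b m else 0) (b m) sequentially"
    by (rule limitin_eventually[OF b])
  ultimately have "limitin X (\<lambda>k. \<Sum>n\<le>k. s (?a n) (b n)) (b m) sequentially" by simp
  moreover have "\<forall>a. limitin X (\<lambda>k. \<Sum>n\<le>k. s (a n) (b n)) (b m) sequentially \<longrightarrow>
      (\<forall>n. a n = l n (b m))"
    using assms(2) b unfolding schauder_basis_def by blast
  ultimately have "?a n = l n (b m)" by (elim allE[of _ ?a]) simp
  then show ?thesis by simp
qed

text \<open>Point evaluations lie in the dual and send \<open>h\<close> to \<open>h x\<close>, so
  \<open>eps_map\<close> turns the operator form of a tensor into its function form.\<close>

lemma eps_map_rank_one:
  assumes "\<And>x. pt_eval F x \<in> top_dual (pw_scale (*)) F" "h \<in> topspace F"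
  shows "eps_map F (rank_one (pw_scale (*)) F s h e) = elem_tensor s h e"
  using assms by (auto simp: eps_map_def rank_one_def elem_tensor_def pt_eval_def)

lemma eps_map_sum: "eps_map F (\<Sum>i\<in>I. u i) = (\<Sum>i\<in>I. eps_map F (u i))"
  by (auto simp: eps_map_def sum_fun_apply)

section \<open>Transfer to the vector-valued function space\<close>

theorem corollary5p6p5:
  fixes s :: "'k::{real_normed_field,heine_borel} \<Rightarrow> 'e::ab_group_add \<Rightarrow> 'e"
    and E :: "'e topology"
    and F :: "('x \<Rightarrow> 'k) topology"
    and FE :: "('x \<Rightarrow> 'e) topology"
    and f :: "nat \<Rightarrow> 'x \<Rightarrow> 'k"
    and lK :: "nat \<Rightarrow> ('x \<Rightarrow> 'k) \<Rightarrow> 'k"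
    and lE :: "nat \<Rightarrow> ('x \<Rightarrow> 'e) \<Rightarrow> 'e"
    and Q P :: "nat \<Rightarrow> ('x \<Rightarrow> 'e) \<Rightarrow> 'x \<Rightarrow> 'e"
  assumes "lcHs s E"
    and "function_space F"
    and "vector_function_space s E FE"
    and "eps_compatible s E F FE"
    and "equicontinuous_schauder_basis (pw_scale (*)) F f lK"
    and "consistent_family s E F FE lE lK"
    and Q_def: "\<And>n g. Q n g = elem_tensor s (f n) (lE n g)"
    and P_def: "\<And>k g. P k g = (\<Sum>n\<le>k. Q n g)"
  shows "schauder_decomposition (pw_scale s) FE P \<and>
    (\<forall>g\<in>topspace FE.
      limitin FE (\<lambda>k. \<Sum>n\<le>k. elem_tensor s (f n) (lE n g)) g sequentially) \<and>
    sequentially_dense FE (tensor_subspace s E F)"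
proof -
  let ?EP = "eps_product (pw_scale (*)) F s E"
  have lF: "lcHs (pw_scale (*)) F" and ev: "\<And>x. pt_eval F x \<in> top_dual (pw_scale (*)) F"
    using assms(2) by (auto simp: function_space_def)
  have lFE: "lcHs (pw_scale s) FE" using assms(3) by (simp add: vector_function_space_def)
  interpret E: lc_space s E by unfold_locales fact
  interpret FE: lc_space "pw_scale s" FE by unfold_locales fact
  have hom: "homeomorphic_map ?EP FE (eps_map F)"
    using assms(4) by (simp add: eps_compatible_def)
  then have contS: "continuous_map ?EP FE (eps_map F)"
    by (rule homeomorphic_imp_continuous_map)
  have surjS: "eps_map F ` topspace ?EP = topspace FE"
    using hom by (rule homeomorphic_imp_surjective_map)
  \<comment> \<open>\<open>R\<close> is the continuous inverse of \<open>eps_map F\<close>; it pulls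
    each \<open>g\<close> back to an operator.\<close>
  obtain R where contR: "continuous_map FE ?EP R"
    and R: "\<And>g. g \<in> topspace FE \<Longrightarrow> eps_map F (R g) = g"
    using hom by (auto simp: homeomorphic_map_maps homeomorphic_maps_def)
  have RX: "R g \<in> topspace ?EP" if "g \<in> topspace FE" for g
    using contR that by (auto simp: continuous_map_def)
  have basis: "schauder_basis (pw_scale (*)) F f lK"
    using assms(5) by (simp add: equicontinuous_schauder_basis_def)
  have f: "f n \<in> topspace F" and lK: "lK n \<in> top_dual (pw_scale (*)) F" for n
    using basis by (auto simp: schauder_basis_def)
  have lE_lin: "linear_map_on (pw_scale s) s (topspace FE) (lE n)"
    and lE_E: "\<And>g. g \<in> topspace FE \<Longrightarrow> lE n g \<in> topspace E"
    and lE_S: "\<And>u. u \<in> topspace ?EP \<Longrightarrow> lE n (eps_map F u) = u (lK n)" for n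
    using assms(6) by (auto simp: consistent_family_def)
  have rank1: "rank_one (pw_scale (*)) F s h e \<in> topspace ?EP"
    if "h \<in> topspace F" "e \<in> topspace E" for h e
    using rank_one_in_cont_linear[OF lF assms(1) that] by (simp add: topspace_eps_product[OF assms(1)])
  have tensor: "elem_tensor s h e \<in> topspace FE" if "h \<in> topspace F" "e \<in> topspace E" for h e
    using rank1[OF that] eps_map_rank_one[OF ev that(1), of s e] surjS by (metis imageI)
  have P: "P k g = (\<Sum>n\<le>k. elem_tensor s (f n) (lE n g))" for k g
    by (simp add: P_def Q_def)
  \<comment> \<open>Consistency demands linearity of \<open>lE n\<close> only; this formula yields
    its continuity, as \<open>R\<close> followed by evaluation at \<open>lK n\<close>.\<close>
  have lE_R: "lE n g = R g (lK n)" if "g \<in> topspace FE" for n g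
    using lE_S[OF RX[OF that]] R[OF that] by simp
  have lE_tensor: "lE n (elem_tensor s (f m) e) = (if n = m then e else 0)"
    if "e \<in> topspace E" for n m e
    using lE_S[OF rank1[OF f that], of n m] eps_map_rank_one[OF ev f, of s m e]
      schauder_basis_biorthogonal[OF lF basis, of n m]
    by (simp add: rank_one_def lK)
  have tensor_lin: "elem_tensor s h (a + b) = elem_tensor s h a + elem_tensor s h b"
    "elem_tensor s h (s c a) = pw_scale s c (elem_tensor s h a)" "elem_tensor s h 0 = 0" for h a b c
    by (auto simp: elem_tensor_def pw_scale_def fun_eq_iff E.scale_right_distrib E.scale_left_commute)
  \<comment> \<open>Each summand is a chain of continuous maps: \<open>R\<close>, evaluation at
    \<open>lK n\<close>, the map sending \<open>e\<close> to the rank-one operator of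
    \<open>f n\<close> and \<open>e\<close>, and \<open>eps_map F\<close>.\<close>
  have contP: "continuous_map FE FE (P k)" for k
    unfolding P[abs_def]
  proof (rule FE.continuous_map_lc_sum)
    fix n
    have "continuous_map FE E (\<lambda>g. R g (lK n))"
      using continuous_map_compose[OF contR continuous_map_eps_product_eval[OF assms(1) lK[of n]]]
      by (simp add: o_def)
    from continuous_map_compose[OF continuous_map_compose[OF this
        continuous_map_rank_one[OF lF assms(1) f[of n]]] contS]
    have "continuous_map FE FE (\<lambda>g. elem_tensor s (f n) (R g (lK n)))"
      by (simp add: o_def eps_map_rank_one[OF ev f])
    then show "continuous_map FE FE (\<lambda>g. elem_tensor s (f n) (lE n g))"
      by (rule continuous_map_eq) (simp add: lE_R)
  qed
  have linP: "linear_map_on (pw_scale s) (pw_scale s) (topspace FE) (P k)" for k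
    using lE_lin
    by (auto simp: linear_map_on_def P tensor_lin sum.distrib FE.scale_sum_right)
  \<comment> \<open>By biorthogonality \<open>P j\<close> truncates the coefficient sequence after
    index \<open>j\<close>. This gives both the composition rule and the distinctness of the
    projections.\<close>
  have lE_P: "lE n (P j g) = (if n \<le> j then lE n g else 0)" if g: "g \<in> topspace FE" for n j g
  proof -
    have "lE n (P j g) = (\<Sum>m\<le>j. lE n (elem_tensor s (f m) (lE m g)))"
      unfolding P
      by (rule linear_map_on_sum[OF _ _ lE_lin FE.subspace_topspace tensor[OF f lE_E[OF g]]])
        unfold_locales
    also have "\<dots> = (\<Sum>m\<le>j. if n = m then lE m g else 0)"
      by (simp add: lE_tensor lE_E[OF g])
    finally show ?thesis by simp
  qed
  have PP: "P k (P j g) = P (min j k) g" if g: "g \<in> topspace FE" for j k g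
  proof -
    have "P k (P j g) = (\<Sum>n\<le>k. if n \<le> j then elem_tensor s (f n) (lE n g) else 0)"
      unfolding P[of k] by (intro sum.cong) (auto simp: lE_P[OF g] tensor_lin(3))
    also have "\<dots> = (\<Sum>n | n \<in> {..k} \<and> n \<le> j. elem_tensor s (f n) (lE n g))"
      by (simp only: sum.inter_filter[OF finite_atMost])
    also have "{n. n \<in> {..k} \<and> n \<le> j} = {..min j k}" by auto
    finally show ?thesis by (simp add: P)
  qed
  have distinct: "\<exists>g\<in>topspace FE. P k g \<noteq> P j g" if "k \<noteq> j" for j k
  proof -
    have "topspace E \<noteq> {0}" using assms(1) by (simp add: lcHs_def)
    then obtain e where e: "e \<in> topspace E" "e \<noteq> 0" using E.zero_in_topspace by blast
    \<comment> \<open>For \<open>k \<noteq> j\<close> the index \<open>max j k\<close> occurs in the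
      longer partial sum but not in the shorter, so its coefficient is \<open>e\<close> for one and
      \<open>0\<close> for the other.\<close>
    let ?g = "elem_tensor s (f (max j k)) e"
    have g: "?g \<in> topspace FE" by (rule tensor[OF f e(1)])
    have "lE (max j k) (P k ?g) \<noteq> lE (max j k) (P j ?g)"
      unfolding lE_P[OF g] lE_tensor[OF e(1)] using that e(2) by auto
    then have "P k ?g \<noteq> P j ?g" by metis
    with g show ?thesis by blast
  qed
  have limP: "limitin FE (\<lambda>k. P k g) g sequentially" if g: "g \<in> topspace FE" for g
  proof -
    have "limitin FE (eps_map F \<circ> (\<lambda>k. \<Sum>n\<le>k. rank_one (pw_scale (*)) F s (f n) (R g (lK n))))
        (eps_map F (R g)) sequentially"
      by (rule continuous_map_limit[OF contS eps_product_expansion[OF lF assms(1,5) RX[OF g]]])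
    then show ?thesis
      by (simp add: o_def eps_map_sum eps_map_rank_one[OF ev f] R[OF g] P lE_R[OF g])
  qed
  have "sequentially_dense FE (tensor_subspace s E F)"
    unfolding sequentially_dense_def tensor_subspace_def
  proof (intro conjI ballI)
    show "FE.span {elem_tensor s f e |f e. f \<in> topspace F \<and> e \<in> topspace E} \<subseteq> topspace FE"
      by (rule FE.span_minimal[OF _ FE.subspace_topspace]) (auto intro: tensor)
  next
    fix g assume g: "g \<in> topspace FE"
    \<comment> \<open>The partial sums are finite sums of elementary tensors, hence are themselves
      the approximating sequence.\<close>
    have "P k g \<in> FE.span {elem_tensor s f e |f e. f \<in> topspace F \<and> e \<in> topspace E}" for k
      unfolding P by (intro FE.span_sum FE.span_base) (use f lE_E[OF g] in blast)
    with limP[OF g]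
    show "\<exists>d. (\<forall>n. d n \<in> FE.span {elem_tensor s f e |f e. f \<in> topspace F \<and> e \<in> topspace E}) \<and>
        limitin FE d g sequentially"
      by (intro exI[of _ "\<lambda>k. P k g"]) simp
  qed
  \<comment> \<open>Idempotence is the case \<open>j = k\<close> of \<open>PP\<close>.\<close>
  moreover have "schauder_decomposition (pw_scale s) FE P"
    unfolding schauder_decomposition_def using contP linP PP distinct limP by simp
  ultimately show ?thesis using limP by (simp add: P)
qed

end
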